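(* Let $n\ge 2$ and let $A$ be an $n\times n$ real Toeplitz matrix satisfying $A+A^{\top}=2J_n$, where $J_n$ is the $n\times n$ matrix all of whose entries equal $1$. Then $$\det A_{n-1}(1,2)+\det A_{n-1}(2,1)=2\det A_{n-1}(1,1).$$
   Context: A matrix $A=(a_{ij})_{1\le i,j\le n}$ is Toeplitz if $a_{ij}$ depends only on $j-i$. For an $n\times n$ matrix $A=(a_{pq})$, integers $1\le r\le n$ and $1\le i,j\le n-r+1$, $A_r(i,j):=(a_{pq})_{i\le p\le i+r-1,\ j\le q\le j+r-1}$ denotes the $r\times r$ contiguous submatrix of $A$ consisting of rows $i,\dots,i+r-1$ and columns $j,\dots,j+r-1$. *)

theory Defs
  imports Complex_Main "Jordan_Normal_Form.Determinant"
begin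

(* Entries of a library matrix are indexed from 0; the difference j - i is unaffected by the shift. *)
definition toeplitz_mat :: "'a mat \<Rightarrow> bool" where
  "toeplitz_mat A \<longleftrightarrow> square_mat A \<and>
     (\<exists>a :: int \<Rightarrow> 'a. \<forall>i < dim_row A. \<forall>j < dim_col A. A $$ (i, j) = a (int j - int i))"

definition all_ones_mat :: "nat \<Rightarrow> 'a :: one mat" where
  "all_ones_mat n = mat n n (\<lambda>_. 1)"

(* Here i and j count from 1, and the value is meaningful only if 1 \<le> i, j
   and i + r - 1, j + r - 1 do not exceed the dimensions of A. *)
definition contiguous_submat :: "'a mat \<Rightarrow> nat \<Rightarrow> nat \<Rightarrow> nat \<Rightarrow> 'a mat" where
  "contiguous_submat A r i j = mat r r (\<lambda>(p, q). A $$ (i - 1 + p, j - 1 + q))"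

end

theory Submission
  imports Defs
begin

text \<open>
  Let \<open>m = n - 1\<close> and \<open>A = J + S\<close> with \<open>S\<close> skew-symmetric Toeplitz, and let \<open>T\<close> be the submatrix of
  \<open>S\<close> on the first \<open>m\<close> rows and last \<open>m\<close> columns. Transposing, the claim becomes
  \<open>F(T) = F(S\<^sub>m)\<close> for \<open>F(X) = det (X + J) + (-1)\<^sup>m det (X - J)\<close>.
  Reversal of coordinates anticommutes with \<open>S\<close>, so counting dimensions on its symmetric (\<open>n\<close> odd) or
  antisymmetric (\<open>n\<close> even) eigenspace gives \<open>u \<noteq> 0\<close> there with \<open>S u\<close> a constant vector, which is zero if
  \<open>n\<close> is odd. Hence \<open>(S + x J) u = r(x) 1\<close> with \<open>r(1) + (-1)\<^sup>m r(-1) = 0\<close>.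
  Since \<open>S\<^sub>m\<close> and \<open>T\<close> share all but one column, Cramer's rule expresses
  \<open>det (S\<^sub>m + x J) - det (T + x J)\<close> as \<open>r(x)\<close> times a determinant with a column of ones, which
  does not depend on \<open>x\<close>, so it cancels in \<open>F\<close>. If the end entries of \<open>u\<close> vanish, both \<open>F(S\<^sub>m)\<close>
  and \<open>F(T)\<close> vanish by the same argument.
\<close>

section \<open>Determinants with one replaced column\<close>

lemma det_col_expansion:
  fixes X :: "nat \<Rightarrow> nat \<Rightarrow> 'a :: comm_ring_1"
  assumes "k < m"
  shows "det (mat m m (\<lambda>(i, j). if j = k then b i else X i j))
    = (\<Sum>i<m. b i * cofactor (mat m m (\<lambda>(i, j). X i j)) i k)"
proof -
  let ?B = "mat m m (\<lambda>(i, j). if j = k then b i else X i j)"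
  have "det ?B = (\<Sum>i<m. ?B $$ (i, k) * cofactor ?B i k)"
    by (rule laplace_expansion_column) (use assms in auto)
  also have "\<dots> = (\<Sum>i<m. b i * cofactor (mat m m (\<lambda>(i, j). X i j)) i k)"
  proof (rule sum.cong[OF refl])
    fix i assume "i \<in> {..<m}"
    then have "mat_delete ?B i k = mat_delete (mat m m (\<lambda>(i, j). X i j)) i k"
      using assms by (intro eq_matI) (auto simp: mat_delete_def)
    with \<open>i \<in> {..<m}\<close> assms show "?B $$ (i, k) * cofactor ?B i k = b i * cofactor (mat m m (\<lambda>(i, j). X i j)) i k"
      by (simp add: cofactor_def)
  qed
  finally show ?thesis .
qed

text \<open>Cramer's rule in product form: nothing is divided by the determinant, so singular
  matrices are covered.\<close>

lemma det_replace_col_mult: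
  fixes X :: "nat \<Rightarrow> nat \<Rightarrow> 'a :: field"
  assumes "k < m" "\<And>i. i < m \<Longrightarrow> (\<Sum>j<m. X i j * v j) = b i"
  shows "det (mat m m (\<lambda>(i, j). if j = k then b i else X i j)) = v k * det (mat m m (\<lambda>(i, j). X i j))"
proof -
  let ?A = "mat m m (\<lambda>(i, j). X i j)"
  have "replace_col ?A (?A *\<^sub>v vec m v) k = mat m m (\<lambda>(i, j). if j = k then b i else X i j)"
    using assms(2)
    by (intro eq_matI) (auto simp: replace_col_def scalar_prod_def lessThan_atLeast0)
  with cramer_lemma_mat[of ?A m "vec m v" k] assms(1) show ?thesis by simp
qed

text \<open>Column \<open>k\<close> consists of ones, so adding \<open>x\<close> times it to every
  other column produces the shift by \<open>x\<close> and preserves the determinant.\<close>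

lemma det_const_col_shift:
  fixes X :: "nat \<Rightarrow> nat \<Rightarrow> 'a :: field"
  assumes "k < m"
  shows "det (mat m m (\<lambda>(i, j). if j = k then 1 else X i j + x))
    = det (mat m m (\<lambda>(i, j). if j = k then 1 else X i j))"
proof -
  \<comment> \<open>The matrix of these column operations, acting by right multiplication. Deleting
    its row and column \<open>k\<close> leaves an identity matrix, whence determinant 1.\<close>
  define E where "E = mat m m (\<lambda>(l, j). if j = k then of_bool (l = k) else of_bool (l = j) + x * of_bool (l = k))"
  let ?Y = "mat m m (\<lambda>(i, j). if j = k then 1 else X i j)"
  have "det E = (\<Sum>i<m. of_bool (i = k) * cofactor (mat m m (\<lambda>(l, j). of_bool (l = j) + x * of_bool (l = k))) i k)"
    unfolding E_def by (rule det_col_expansion[OF assms])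
  also have "\<dots> = cofactor (mat m m (\<lambda>(l, j). of_bool (l = j) + x * of_bool (l = k))) k k"
    using assms by (subst sum.remove[of _ k]) (auto intro!: sum.neutral)
  also have "\<dots> = 1"
  proof -
    have "mat_delete (mat m m (\<lambda>(l, j). of_bool (l = j) + x * of_bool (l = k))) k k = 1\<^sub>m (m - 1)"
      using assms by (intro eq_matI) (auto simp: mat_delete_def)
    then show ?thesis by (simp add: cofactor_def)
  qed
  finally have "det E = 1" .
  have "?Y * E = mat m m (\<lambda>(i, j). if j = k then 1 else X i j + x)"
  proof (rule eq_matI)
    fix i j assume "i < dim_row (mat m m (\<lambda>(i, j). if j = k then 1 else X i j + x))"
      "j < dim_col (mat m m (\<lambda>(i, j). if j = k then 1 else X i j + x))"
    then have ij: "i < m" "j < m" by auto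
    let ?y = "\<lambda>l. if l = k then 1 else X i l"
    have "(?Y * E) $$ (i, j) = (\<Sum>l = 0..<m. ?y l * (if j = k then of_bool (l = k) else of_bool (l = j) + x * of_bool (l = k)))"
      using ij by (simp add: E_def scalar_prod_def)
    also have "\<dots> = (\<Sum>l = 0..<m. (if l = j then ?y l else 0) + (if l = k then if j = k then 0 else x else 0))"
      by (rule sum.cong) auto
    also have "\<dots> = (if j = k then 1 else X i j + x)"
      using ij assms by (simp add: sum.distrib)
    finally show "(?Y * E) $$ (i, j) = mat m m (\<lambda>(i, j). if j = k then 1 else X i j + x) $$ (i, j)"
      using ij by simp
  qed (auto simp: E_def)
  with det_mult[of ?Y m E] \<open>det E = 1\<close> show ?thesis by (simp add: E_def)
qed

text \<open>Moving the first column past the other \<open>m - 1\<close> columns restores the order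
  1, ..., \<open>m\<close> of the columns of \<open>X\<close>.\<close>

lemma det_cyclic_cols:
  fixes X :: "nat \<Rightarrow> nat \<Rightarrow> 'a :: comm_ring_1"
  assumes "m > 0"
  shows "det (mat m m (\<lambda>(i, j). if j = 0 then X i m else X i j))
    = (-1) ^ (m - 1) * det (mat m m (\<lambda>(i, j). X i (Suc j)))"
proof -
  let ?R = "mat m m (\<lambda>(i, j). if j = 0 then X i m else X i j)"
  have "det ?R = (-1) ^ (1 * (m - 1)) * det (mat m m (\<lambda>(i, j). ?R $$ (i, if j < m - 1 then j + 1 else if j < 1 + (m - 1) then j - (m - 1) else j)))"
    by (rule det_swap_initial_cols) (use assms in auto)
  also have "mat m m (\<lambda>(i, j). ?R $$ (i, if j < m - 1 then j + 1 else if j < 1 + (m - 1) then j - (m - 1) else j))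
    = mat m m (\<lambda>(i, j). X i (Suc j))"
    by (rule eq_matI) (auto, metis Suc_pred not_less_less_Suc_eq assms)
  finally show ?thesis by simp
qed

section \<open>Vectors mapped to constants by a skew Toeplitz matrix\<close>

lemma underdetermined_system_solution:
  fixes G :: "nat \<Rightarrow> nat \<Rightarrow> 'a :: field"
  obtains w where "\<exists>k\<le>h. w k \<noteq> 0" "\<And>i. i < h \<Longrightarrow> (\<Sum>k\<le>h. G i k * w k) = 0"
proof -
  \<comment> \<open>A zero row pads the \<open>h\<close> equations to a singular square
    system.\<close>
  define M where "M = mat (Suc h) (Suc h) (\<lambda>(i, k). if i < h then G i k else 0)"
  have M: "M \<in> carrier_mat (Suc h) (Suc h)" by (simp add: M_def)
  have "row M h = 0\<^sub>v (Suc h)" by (auto simp: M_def)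
  then have "det M = 0"
    using laplace_expansion_row[OF M, of h] by (simp add: M_def)
  then obtain v where v: "v \<in> carrier_vec (Suc h)" "v \<noteq> 0\<^sub>v (Suc h)" "M *\<^sub>v v = 0\<^sub>v (Suc h)"
    using det_0_iff_vec_prod_zero_field[OF M] by auto
  show thesis
  proof (rule that)
    show "\<exists>k\<le>h. v $ k \<noteq> 0"
      using v(1,2) by (metis carrier_vecD dim_vec eq_vecI index_zero_vec less_Suc_eq_le)
    fix i assume "i < h"
    then have "(M *\<^sub>v v) $ i = (\<Sum>k\<le>h. G i k * v $ k)"
      using v(1) by (simp add: M_def scalar_prod_def lessThan_Suc_atMost[symmetric] lessThan_atLeast0 del: sum.op_ivl_Suc)
    with v(3) \<open>i < h\<close> show "(\<Sum>k\<le>h. G i k * v $ k) = 0" by simp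
  qed
qed

text \<open>Pairs each index with its mirror image, so that a vector of known parity under reversal
  enters only through half of its entries. The induction peels off both ends.\<close>

lemma sum_fold_even:
  fixes f :: "nat \<Rightarrow> 'a :: comm_monoid_add"
  shows "(\<Sum>j<2 * h. f j) = (\<Sum>k<h. f k + f (2 * h - 1 - k))"
proof (induction h arbitrary: f)
  case (Suc h)
  have "(\<Sum>j<2 * Suc h. f j) = f 0 + (\<Sum>j<2 * h. f (Suc j)) + f (2 * h + 1)"
    using sum.lessThan_Suc_shift[of f "2 * h"] by simp
  also have "\<dots> = f 0 + f (2 * h + 1) + (\<Sum>k<h. f (Suc k) + f (Suc (2 * h - 1 - k)))"
    unfolding Suc by (simp add: ac_simps)
  also have "(\<Sum>k<h. f (Suc k) + f (Suc (2 * h - 1 - k))) = (\<Sum>k<h. f (Suc k) + f (2 * Suc h - 1 - Suc k))"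
    by (rule sum.cong) (auto simp: Suc_diff_Suc)
  finally show ?case by (simp add: sum.lessThan_Suc_shift del: sum.lessThan_Suc)
qed simp

lemma sum_fold_odd:
  fixes f :: "nat \<Rightarrow> 'a :: comm_monoid_add"
  shows "(\<Sum>j\<le>2 * h. f j) = (\<Sum>k<h. f k + f (2 * h - k)) + f h"
proof (induction h arbitrary: f)
  case (Suc h)
  have "(\<Sum>j\<le>2 * Suc h. f j) = f 0 + (\<Sum>j\<le>2 * h. f (Suc j)) + f (2 * h + 2)"
    using sum.atMost_Suc_shift[of f "2 * h"] by simp
  also have "\<dots> = f 0 + f (2 * h + 2) + (\<Sum>k<h. f (Suc k) + f (Suc (2 * h - k))) + f (Suc h)"
    unfolding Suc by (simp add: ac_simps)
  also have "(\<Sum>k<h. f (Suc k) + f (Suc (2 * h - k))) = (\<Sum>k<h. f (Suc k) + f (2 * Suc h - Suc k))"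
    by (rule sum.cong) (auto simp: Suc_diff_le)
  finally show ?case by (simp add: sum.lessThan_Suc_shift del: sum.lessThan_Suc)
qed simp

text \<open>A symmetric vector of length \<open>2 * h + 1\<close> has \<open>h + 1\<close> free
  entries. Its image is antisymmetric, so only the first \<open>h\<close> rows impose conditions and
  the middle row vanishes by itself.\<close>

lemma skew_toeplitz_kernel_even:
  fixes s :: "int \<Rightarrow> real"
  assumes odd: "\<And>d. s (- d) = - s d"
  obtains u where "\<exists>j\<le>2 * h. u j \<noteq> 0" "\<And>j. j \<le> 2 * h \<Longrightarrow> u (2 * h - j) = u j"
    "\<And>i. i \<le> 2 * h \<Longrightarrow> (\<Sum>j\<le>2 * h. s (int j - int i) * u j) = 0"
proof -
  let ?G = "\<lambda>i k. if k < h then s (int k - int i) + s (int (2 * h - k) - int i) else s (int k - int i)"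
  obtain w where w: "\<exists>k\<le>h. w k \<noteq> 0" "\<And>i. i < h \<Longrightarrow> (\<Sum>k\<le>h. ?G i k * w k) = 0"
    using underdetermined_system_solution[of h ?G] by blast
  define u where "u j = w (min j (2 * h - j))" for j
  define g where "g i = (\<Sum>j\<le>2 * h. s (int j - int i) * u j)" for i
  have sym: "u (2 * h - j) = u j" if "j \<le> 2 * h" for j
    using that by (simp add: u_def min.commute)
  have low: "g i = 0" if "i < h" for i
  proof -
    have "g i = (\<Sum>k<h. ?G i k * w k) + s (int h - int i) * w h"
      unfolding g_def sum_fold_odd by (intro arg_cong2[of _ _ _ _ "(+)"] sum.cong) (auto simp: u_def algebra_simps)
    also have "\<dots> = (\<Sum>k\<le>h. ?G i k * w k)" by (simp flip: lessThan_Suc_atMost)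
    finally show ?thesis using w(2)[OF that] by simp
  qed
  have refl: "g (2 * h - i) = - g i" if "i \<le> 2 * h" for i
  proof -
    have "g (2 * h - i) = (\<Sum>j\<le>2 * h. s (int (2 * h - j) - int (2 * h - i)) * u (2 * h - j))"
      unfolding g_def by (rule sum.reindex_bij_witness[of _ "\<lambda>j. 2 * h - j" "\<lambda>j. 2 * h - j"]) auto
    also have "\<dots> = (\<Sum>j\<le>2 * h. - (s (int j - int i) * u j))"
    proof (rule sum.cong[OF refl])
      fix j assume "j \<in> {..2 * h}"
      then have "int (2 * h - j) - int (2 * h - i) = - (int j - int i)" using that by auto
      then have "s (int (2 * h - j) - int (2 * h - i)) = - s (int j - int i)" by (simp only: odd)
      with sym \<open>j \<in> {..2 * h}\<close>
      show "s (int (2 * h - j) - int (2 * h - i)) * u (2 * h - j) = - (s (int j - int i) * u j)" by simp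
    qed
    finally show ?thesis by (simp add: g_def sum_negf)
  qed
  show thesis
  proof (rule that[of u])
    from w(1) obtain k where "k \<le> h" "w k \<noteq> 0" by auto
    then show "\<exists>j\<le>2 * h. u j \<noteq> 0" by (intro exI[of _ k]) (auto simp: u_def min_def)
    fix i assume i: "i \<le> 2 * h"
    have "g i = 0"
    proof (cases i h rule: linorder_cases)
      case equal then show ?thesis using refl[of h] by simp
    next
      case greater then show ?thesis using refl[OF i] low[of "2 * h - i"] i by simp
    qed (fact low)
    then show "(\<Sum>j\<le>2 * h. s (int j - int i) * u j) = 0" by (simp add: g_def)
  qed (fact sym)
qed

text \<open>An antisymmetric vector of length \<open>2 * h\<close> has \<open>h\<close> free entries
  and a symmetric image. The unknown constant is one further variable, against \<open>h\<close>
  equations.\<close>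

lemma skew_toeplitz_kernel_odd:
  fixes s :: "int \<Rightarrow> real"
  assumes odd: "\<And>d. s (- d) = - s d" and "h > 0"
  obtains u t where "\<exists>j<2 * h. u j \<noteq> 0" "\<And>j. j < 2 * h \<Longrightarrow> u (2 * h - 1 - j) = - u j"
    "\<And>i. i < 2 * h \<Longrightarrow> (\<Sum>j<2 * h. s (int j - int i) * u j) = - t"
proof -
  \<comment> \<open>The column of ones at index \<open>h\<close> makes \<open>w h\<close> the
    negative of the common value of the image.\<close>
  let ?G = "\<lambda>i k. if k < h then s (int k - int i) - s (int (2 * h - 1 - k) - int i) else 1"
  obtain w where w: "\<exists>k\<le>h. w k \<noteq> 0" "\<And>i. i < h \<Longrightarrow> (\<Sum>k\<le>h. ?G i k * w k) = 0"
    using underdetermined_system_solution[of h ?G] by blast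
  define u where "u j = (if j < h then w j else - w (2 * h - 1 - j))" for j
  define g where "g i = (\<Sum>j<2 * h. s (int j - int i) * u j)" for i
  have anti: "u (2 * h - 1 - j) = - u j" if "j < 2 * h" for j
    using that by (auto simp: u_def)
  have low: "g i = - w h" if "i < h" for i
  proof -
    have "g i = (\<Sum>k<h. ?G i k * w k)"
      unfolding g_def sum_fold_even by (intro sum.cong) (auto simp: u_def algebra_simps)
    moreover have "\<dots> + w h = (\<Sum>k\<le>h. ?G i k * w k)" by (simp flip: lessThan_Suc_atMost)
    ultimately show ?thesis using w(2)[OF that] by simp
  qed
  have refl: "g (2 * h - 1 - i) = g i" if "i < 2 * h" for i
  proof -
    have "g (2 * h - 1 - i) = (\<Sum>j<2 * h. s (int (2 * h - 1 - j) - int (2 * h - 1 - i)) * u (2 * h - 1 - j))"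
      unfolding g_def by (rule sum.reindex_bij_witness[of _ "\<lambda>j. 2 * h - 1 - j" "\<lambda>j. 2 * h - 1 - j"]) auto
    also have "\<dots> = (\<Sum>j<2 * h. s (int j - int i) * u j)"
    proof (rule sum.cong[OF refl])
      fix j assume "j \<in> {..<2 * h}"
      then have "int (2 * h - 1 - j) - int (2 * h - 1 - i) = - (int j - int i)" using that by auto
      then have "s (int (2 * h - 1 - j) - int (2 * h - 1 - i)) = - s (int j - int i)" by (simp only: odd)
      with anti[of j] \<open>j \<in> {..<2 * h}\<close>
      show "s (int (2 * h - 1 - j) - int (2 * h - 1 - i)) * u (2 * h - 1 - j) = s (int j - int i) * u j" by simp
    qed
    finally show ?thesis by (simp add: g_def)
  qed
  \<comment> \<open>Otherwise \<open>u\<close> is zero, hence so is its image, which forces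
    \<open>w h = 0\<close> as well.\<close>
  have "\<exists>k<h. w k \<noteq> 0"
  proof (rule ccontr)
    assume *: "\<not> ?thesis"
    then have "g 0 = 0" by (auto simp: g_def u_def intro!: sum.neutral)
    with low[of 0] \<open>h > 0\<close> have "w h = 0" by simp
    with * w(1) show False by (metis le_eq_less_or_eq)
  qed
  then obtain k where k: "k < h" "w k \<noteq> 0" by auto
  show thesis
  proof (rule that[of u "w h"])
    show "\<exists>j<2 * h. u j \<noteq> 0" using k by (intro exI[of _ k]) (auto simp: u_def)
    fix i assume i: "i < 2 * h"
    have "g i = - w h"
      using refl[OF i] low[of "2 * h - 1 - i"] low[of i] i by (cases "i < h") auto
    then show "(\<Sum>j<2 * h. s (int j - int i) * u j) = - w h" by (simp add: g_def)
  qed (fact anti)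
qed

lemma skew_toeplitz_solution:
  fixes s :: "int \<Rightarrow> real"
  assumes odd: "\<And>d. s (- d) = - s d"
  obtains u r where "\<exists>j\<le>m. u j \<noteq> 0" "u m = (-1) ^ m * u 0"
    "\<And>x i. i \<le> m \<Longrightarrow> (\<Sum>j\<le>m. (s (int j - int i) + x) * u j) = r x"
    "r 1 + (-1) ^ m * r (-1) = 0"
proof (cases "even m")
  case True
  then obtain h where m: "m = 2 * h" by auto
  obtain u where u: "\<exists>j\<le>2 * h. u j \<noteq> 0" "\<And>j. j \<le> 2 * h \<Longrightarrow> u (2 * h - j) = u j"
    "\<And>i. i \<le> 2 * h \<Longrightarrow> (\<Sum>j\<le>2 * h. s (int j - int i) * u j) = 0"
    using skew_toeplitz_kernel_even[of s h] odd by blast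
  \<comment> \<open>The skew part annihilates \<open>u\<close>, so only the shift contributes and
    \<open>r\<close> is odd.\<close>
  show ?thesis
    by (rule that[of u "\<lambda>x. x * (\<Sum>j\<le>m. u j)"])
      (use u(1) u(2)[of 0] u(3) in \<open>auto simp: m distrib_right sum.distrib sum_distrib_left sum_negf\<close>)
next
  case False
  define h where "h = (m + 1) div 2"
  have h: "h > 0" "{..m} = {..<2 * h}" "\<And>j. j \<le> m \<longleftrightarrow> j < 2 * h" "m = 2 * h - 1" using False by (auto simp: h_def elim!: oddE)
  obtain u t where u: "\<exists>j<2 * h. u j \<noteq> 0" "\<And>j. j < 2 * h \<Longrightarrow> u (2 * h - 1 - j) = - u j"
    "\<And>i. i < 2 * h \<Longrightarrow> (\<Sum>j<2 * h. s (int j - int i) * u j) = - t"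
    using skew_toeplitz_kernel_odd[of s h] odd h(1) by blast
  \<comment> \<open>By antisymmetry the shift annihilates \<open>u\<close>, so \<open>r\<close> is
    constant.\<close>
  have "(\<Sum>j<2 * h. u j) = 0" unfolding sum_fold_even using u(2) by (intro sum.neutral) auto
  then show ?thesis
    by (intro that[of u "\<lambda>_. - t"])
      (use u(1) u(2)[of 0] u(3) h False in \<open>auto simp: distrib_right sum.distrib simp flip: sum_distrib_left\<close>)
qed

section \<open>Comparison of the shifted minors\<close>

lemma skew_toeplitz_shifted_minors:
  fixes s :: "int \<Rightarrow> real" and m :: nat
  assumes odd: "\<And>d. s (- d) = - s d" and m: "m > 0"
  defines "S \<equiv> \<lambda>x. det (mat m m (\<lambda>(i, j). s (int j - int i) + x))"
  defines "T \<equiv> \<lambda>x. det (mat m m (\<lambda>(i, j). s (int (Suc j) - int i) + x))"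
  shows "T 1 + (-1) ^ m * T (-1) = S 1 + (-1) ^ m * S (-1)"
proof -
  obtain u r where u: "\<exists>j\<le>m. u j \<noteq> 0" "u m = (-1) ^ m * u 0"
    "\<And>x i. i \<le> m \<Longrightarrow> (\<Sum>j\<le>m. (s (int j - int i) + x) * u j) = r x"
    "r 1 + (-1) ^ m * r (-1) = 0"
    using skew_toeplitz_solution[of s m] odd by blast
  show ?thesis
  proof (cases "u 0 = 0")
    case False
    define X where "X x i j = s (int j - int i) + x" for x and i j :: nat
    define D where "D = det (mat m m (\<lambda>(i, j). if j = 0 then 1 else X 0 i j))"
    have "u 0 * (S x - T x) = r x * D" for x
    proof -
      let ?C = "\<lambda>i. cofactor (mat m m (\<lambda>(i, j). X x i j)) i 0"
      \<comment> \<open>With the last term of each row moved to the right, the first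
        \<open>m\<close> entries of \<open>u\<close> solve a square system with the matrix of
        \<open>S x\<close>.\<close>
      have "u 0 * S x = det (mat m m (\<lambda>(i, j). if j = 0 then r x - u m * X x i m else X x i j))"
        unfolding S_def X_def[symmetric]
      proof (rule det_replace_col_mult[OF m, symmetric])
        fix i assume "i < m"
        with u(3)[of i x] show "(\<Sum>j<m. X x i j * u j) = r x - u m * X x i m"
          by (simp add: X_def mult.commute[of "u m"] eq_diff_eq flip: lessThan_Suc_atMost)
      qed
      also have "\<dots> = r x * (\<Sum>i<m. 1 * ?C i) - u m * (\<Sum>i<m. X x i m * ?C i)"
        unfolding det_col_expansion[OF m] by (simp add: algebra_simps sum_subtractf sum_distrib_left)
      also have "(\<Sum>i<m. 1 * ?C i) = D"
        unfolding det_col_expansion[OF m, symmetric] D_def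
        using det_const_col_shift[OF m, of "X 0" x] by (simp add: X_def cong: if_cong)
      also have "(\<Sum>i<m. X x i m * ?C i) = (-1) ^ (m - 1) * T x"
        unfolding det_col_expansion[OF m, symmetric] det_cyclic_cols[OF m] T_def by (simp add: X_def)
      \<comment> \<open>The parity of \<open>u\<close> and the sign of the cyclic shift combine to
        -1 for every \<open>m\<close>.\<close>
      also have "u m * ((-1) ^ (m - 1) * T x) = - (u 0 * T x)"
        using m u(2) by (cases m; cases "even (m - 1)") auto
      finally show ?thesis by (simp add: algebra_simps)
    qed
    then have *: "S x = T x + r x * (D / u 0)" for x
      using False by (simp add: field_simps)
    have "S 1 + (-1) ^ m * S (-1) = T 1 + (-1) ^ m * T (-1) + (r 1 + (-1) ^ m * r (-1)) * (D / u 0)"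
      unfolding * by (simp only: distrib_left distrib_right add.assoc add.commute add.left_commute mult.assoc)
    with u(4) show ?thesis by simp
  next
    case True
    then have um: "u m = 0" using u(2) by simp
    \<comment> \<open>Both end entries vanish, so a nonzero entry lies strictly inside and survives
      deleting either end.\<close>
    obtain k where "k \<le> m" "u k \<noteq> 0" using u(1) by auto
    then have k: "k < m" "k > 0" "u k \<noteq> 0" using True um by (auto simp: le_less intro: Nat.gr0I)
    \<comment> \<open>Cramer's rule at a nonzero entry \<open>v l\<close> makes the determinant
      \<open>r x\<close> times a factor free of \<open>x\<close>.\<close>
    have vanish: "det (mat m m (\<lambda>(i, j). Y i j + 1)) + (-1) ^ m * det (mat m m (\<lambda>(i, j). Y i j + - 1)) = 0"
      if "l < m" "v l \<noteq> 0" "\<And>x i. i < m \<Longrightarrow> (\<Sum>j<m. (Y i j + x) * v j) = r x" for Y l v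
    proof -
      define D where "D = det (mat m m (\<lambda>(i, j). if j = l then 1 else Y i j))"
      have "v l * det (mat m m (\<lambda>(i, j). Y i j + x)) = r x * D" for x
      proof -
        have "v l * det (mat m m (\<lambda>(i, j). Y i j + x))
          = det (mat m m (\<lambda>(i, j). if j = l then r x else Y i j + x))"
          by (rule det_replace_col_mult[OF \<open>l < m\<close>, symmetric]) (rule that(3))
        also have "\<dots> = r x * det (mat m m (\<lambda>(i, j). if j = l then 1 else Y i j + x))"
          by (simp add: det_col_expansion[OF \<open>l < m\<close>] sum_distrib_left)
        finally show ?thesis by (simp add: D_def det_const_col_shift[OF \<open>l < m\<close>])
      qed
      then have *: "det (mat m m (\<lambda>(i, j). Y i j + x)) = r x * (D / v l)" for x
        using that(2) by (simp add: nonzero_eq_divide_eq mult.commute)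
      have "det (mat m m (\<lambda>(i, j). Y i j + 1)) + (-1) ^ m * det (mat m m (\<lambda>(i, j). Y i j + - 1))
        = (r 1 + (-1) ^ m * r (-1)) * (D / v l)"
        unfolding * by (simp only: distrib_right mult.assoc)
      with u(4) show ?thesis by simp
    qed
    have "S 1 + (-1) ^ m * S (-1) = 0"
      unfolding S_def
    proof (rule vanish[where l = k and v = u])
      fix x i assume "i < m"
      with u(3)[of i x] um show "(\<Sum>j<m. (s (int j - int i) + x) * u j) = r x"
        by (simp flip: lessThan_Suc_atMost)
    qed (use k in auto)
    \<comment> \<open>Dropping the zero entry \<open>u 0\<close> leaves columns 1 to
      \<open>m\<close>, which form \<open>T\<close>; the nonzero index moves from \<open>k\<close>
      to \<open>k - 1\<close>.\<close>
    moreover have "T 1 + (-1) ^ m * T (-1) = 0"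
      unfolding T_def
    proof (rule vanish[where l = "k - 1" and v = "\<lambda>j. u (Suc j)"])
      fix x i assume "i < m"
      with u(3)[of i x] True show "(\<Sum>j<m. (s (int (Suc j) - int i) + x) * u (Suc j)) = r x"
        by (simp add: sum.lessThan_Suc_shift flip: lessThan_Suc_atMost del: sum.lessThan_Suc)
    qed (use k in auto)
    ultimately show ?thesis by simp
  qed
qed

section \<open>Reduction to the shifted minors\<close>

theorem mainTheorem1:
  fixes A :: "real mat" and n :: nat
  assumes "n \<ge> 2"
    and "A \<in> carrier_mat n n"
    and "toeplitz_mat A"
    and "A + transpose_mat A = 2 \<cdot>\<^sub>m all_ones_mat n"
  shows "det (contiguous_submat A (n - 1) 1 2) + det (contiguous_submat A (n - 1) 2 1)
       = 2 * det (contiguous_submat A (n - 1) 1 1)"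
proof -
  define m where "m = n - 1"
  have m: "m > 0" "n = Suc m" using assms(1) by (auto simp: m_def)
  obtain a where a: "\<And>i j. i < n \<Longrightarrow> j < n \<Longrightarrow> A $$ (i, j) = a (int j - int i)"
    using assms(2,3) by (auto simp: toeplitz_mat_def)
  \<comment> \<open>Antisymmetrizing \<open>a\<close> makes \<open>s\<close> odd at every integer,
    even where \<open>A\<close> does not constrain \<open>a\<close>.\<close>
  define s where "s d = (a d - a (- d)) / 2" for d
  have odd: "s (- d) = - s d" for d by (simp add: s_def field_simps)
  have A: "A $$ (i, j) = s (int j - int i) + 1" if "i < n" "j < n" for i j
  proof -
    have "(A + transpose_mat A) $$ (i, j) = (2 \<cdot>\<^sub>m all_ones_mat n) $$ (i, j)" using assms(4) by simp
    with that assms(2) a[of i j] a[of j i] show ?thesis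
      by (simp add: all_ones_mat_def s_def field_simps)
  qed
  define S where "S x = mat m m (\<lambda>(i, j). s (int j - int i) + x)" for x
  define T where "T x = mat m m (\<lambda>(i, j). s (int (Suc j) - int i) + x)" for x
  have neg_transpose: "det (mat m m (\<lambda>(i, j). - X j i)) = (-1) ^ m * det (mat m m (\<lambda>(i, j). X i j))"
    for X :: "nat \<Rightarrow> nat \<Rightarrow> real"
  proof -
    have "mat m m (\<lambda>(i, j). - X j i) = (-1) \<cdot>\<^sub>m transpose_mat (mat m m (\<lambda>(i, j). X i j))"
      by (rule eq_matI) auto
    then show ?thesis by (simp add: det_transpose[of _ m])
  qed
  have "contiguous_submat A m 1 1 = S 1" "contiguous_submat A m 1 2 = T 1"
    using m(2) by (auto simp: contiguous_submat_def S_def T_def A intro!: eq_matI)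
  \<comment> \<open>A second expression for the central minor, as a negated transpose with shift -1;
    the two together account for the factor 2.\<close>
  moreover have "contiguous_submat A m 1 1 = mat m m (\<lambda>(i, j). - (s (int i - int j) + - 1))"
  proof (rule eq_matI)
    fix i j assume "i < dim_row (mat m m (\<lambda>(i, j). - (s (int i - int j) + - 1)))"
      "j < dim_col (mat m m (\<lambda>(i, j). - (s (int i - int j) + - 1)))"
    with m(2) odd[of "int i - int j"]
    show "contiguous_submat A m 1 1 $$ (i, j) = mat m m (\<lambda>(i, j). - (s (int i - int j) + - 1)) $$ (i, j)"
      by (simp add: contiguous_submat_def A)
  qed (auto simp: contiguous_submat_def)
  then have "det (contiguous_submat A m 1 1) = (-1) ^ m * det (S (-1))"
    unfolding S_def by (simp only: neg_transpose)
  moreover have "contiguous_submat A m 2 1 = mat m m (\<lambda>(i, j). - (s (int (Suc i) - int j) + - 1))"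
  proof (rule eq_matI)
    fix i j assume "i < dim_row (mat m m (\<lambda>(i, j). - (s (int (Suc i) - int j) + - 1)))"
      "j < dim_col (mat m m (\<lambda>(i, j). - (s (int (Suc i) - int j) + - 1)))"
    with m(2) odd[of "int (Suc i) - int j"]
    show "contiguous_submat A m 2 1 $$ (i, j) = mat m m (\<lambda>(i, j). - (s (int (Suc i) - int j) + - 1)) $$ (i, j)"
      by (simp add: contiguous_submat_def A)
  qed (auto simp: contiguous_submat_def)
  then have "det (contiguous_submat A m 2 1) = (-1) ^ m * det (T (-1))"
    unfolding T_def by (simp only: neg_transpose)
  ultimately show ?thesis
    using skew_toeplitz_shifted_minors[of s m] odd m(1)
    unfolding m_def[symmetric] S_def T_def by simp
qed

end
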